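(* For each $k\in\{0,1,2,\dots\}$ there exist polynomials $P_{k,0},\dots,P_{k,2k}\in\mathbb{Q}[x]$ such that for all $n$ $$M(d^k;n):=\sum_{\lambda\in\Pi(n)}d(\lambda)^k=P_{k,2k}(n)B_{n+2k}+P_{k,2k-1}(n)B_{n+2k-1}+\dots+P_{k,0}(n)B_n,$$ where the degree of $P_{k,2k-j}$ is at most $j$ if $j\le k$ and at most $k-\lceil\frac{j-k}{2}\rceil$ if $j>k$. For example, $$\sum_{\lambda\in\Pi(n)}d(\lambda)=-2B_{n+2}+(n+4)B_{n+1},$$ $$\sum_{\lambda\in\Pi(n)}d(\lambda)^2=4B_{n+4}-(4n+15)B_{n+3}+(n^2+8n+9)B_{n+2}-(4n+3)B_{n+1}+nB_n.$$
   Context: $\Pi(n)$ is the set of set partitions of $[n]=\{1,\dots,n\}$ and $B_n=|\Pi(n)|$ is the $n$th Bell number. For $\lambda\in\Pi(n)$ with blocks $\mathbf{B}_1,\dots,\mathbf{B}_\ell$, the dimension exponent is $d(\lambda)=\sum_{i=1}^{\ell}(\max\mathbf{B}_i-\min\mathbf{B}_i+1)-n$; equivalently $d(\lambda)=\sum_{(e,f)}(f-e-1)$, the sum over pairs $e<f$ in the same block with no element of that block strictly between them. *)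

theory Defs
  imports
    Complex_Main
    "HOL-Library.Disjoint_Sets"
    "HOL-Computational_Algebra.Polynomial"
begin

definition set_partitions :: "nat \<Rightarrow> nat set set set" where
  "set_partitions n = {\<pi>. partition_on {1..n} \<pi>}"

definition bell :: "nat \<Rightarrow> nat" where
  "bell n = card (set_partitions n)"

(* Integer-valued, so that the subtractions do not truncate. *)
definition dim_exponent :: "nat \<Rightarrow> nat set set \<Rightarrow> int" where
  "dim_exponent n \<pi> = (\<Sum>B\<in>\<pi>. int (Max B) - int (Min B) + 1) - int n"

definition dim_moment :: "nat \<Rightarrow> nat \<Rightarrow> int" where
  "dim_moment k n = (\<Sum>\<pi>\<in>set_partitions n. dim_exponent n \<pi> ^ k)"

end

theory Submission
  imports Defs "HOL-Library.Function_Algebras"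
begin

text \<open>
  Cut a set partition after its first \<open>n\<close> elements and record the set \<open>S\<close> of blocks that are still
  open. If \<open>m\<close> blocks are open, the next element adds \<open>m\<close> to the dimension exponent when it starts a
  block and \<open>m - 1\<close> when it continues one of them. Weighting the open blocks with the Charlier
  polynomial of degree \<open>m\<close> turns this transfer rule into operators on polynomials in \<open>v\<close>: with
  \<open>Y f (v) = v f (v - 1)\<close> (\<open>raising\<close>), \<open>D f (v) = f (v + 1)\<close> (\<open>shifting\<close>) and \<open>Z = (Y - 1) (D - 1)\<close>
  (\<open>number_op\<close>), whose eigenvectors are the Charlier polynomials, the weighted moments satisfy
  \<open>\<phi>\<^sub>k (n + 1) = (\<Sum>j\<le>k. (k choose j) Y Z\<^sup>j D \<phi>\<^bsub>k-j\<^esub> (n))\<close>, and \<open>M(d\<^sup>k; n) = L (\<phi>\<^sub>k (n))\<close> for the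
  linear functional \<open>L\<close> with \<open>L 1 = 1\<close> and \<open>L \<circ> Y = L\<close>, which sends \<open>v\<^sup>n\<close> to the Bell number \<open>B\<^sub>n\<close>.

  Since \<open>Y D\<close> is multiplication by \<open>v\<close>, the recurrence is first order and is solved explicitly: \<open>\<phi>\<^sub>k\<close>
  is a combination of \<open>Y\<^sup>b n\<^sup>e v\<^bsup>n+i\<^esup>\<close> and \<open>D\<^sup>b n\<^sup>e v\<^bsup>n+i\<^esup>\<close> with \<open>b + e + i \<le> 2k\<close> and \<open>2e - i \<le> k\<close> (even
  \<open>2e - i < k\<close> if \<open>b \<noteq> 0\<close>). After applying \<open>L\<close>, the two inequalities \<open>e + i \<le> 2k\<close> and \<open>2e \<le> k + i\<close>
  for the terms \<open>n\<^sup>e B\<^bsub>n+i\<^esub>\<close> are exactly the asserted degree bounds.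
\<close>

section \<open>Set partitions with open blocks\<close>

lemma partition_on_remove:
  assumes "partition_on A P" "B \<in> insert {} P"
  shows "partition_on (A - B) (P - {B})"
proof (cases "B = {}")
  case True
  then show ?thesis
    using assms(1) partition_onD3[OF assms(1)] by simp
next
  case False
  then have "B \<in> P" using assms(2) by simp
  moreover have "disjnt B (\<Union>(P - {B}))"
    using assms(1) \<open>B \<in> P\<close> unfolding partition_on_def disjoint_def disjnt_def by blast
  ultimately show ?thesis
    using partition_on_insert[of B "P - {B}" A] assms(1) by (simp add: insert_absorb)
qed

lemma partition_on_insert_into_block:
  assumes "partition_on A P" "a \<notin> A" "B \<in> insert {} P"
  shows "partition_on (insert a A) (insert (insert a B) (P - {B}))"
proof -
  have rest: "partition_on (A - B) (P - {B})" using partition_on_remove assms(1,3) .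
  then have "disjnt (insert a B) (\<Union>(P - {B}))"
    using assms(2) partition_onD1[OF rest] by (auto simp: disjnt_def)
  moreover have "insert a A - insert a B = A - B" using assms(2) by blast
  moreover have "B \<subseteq> A" using assms(3) partition_onD1[OF assms(1)] by auto
  ultimately show ?thesis using rest by (auto simp: partition_on_insert)
qed

lemma partition_on_insertE:
  assumes "partition_on (insert a A) Q" "a \<notin> A"
  obtains P B where "partition_on A P" "B \<in> insert {} P" "Q = insert (insert a B) (P - {B})"
proof -
  obtain C where C: "C \<in> Q" "a \<in> C" using partition_onD1[OF assms(1)] by blast
  define B where "B = C - {a}"
  have insB: "insert a B = C" using C(2) by (auto simp: B_def)
  have rest: "partition_on (A - B) (Q - {C})"
  proof -
    have "insert a A - C = A - B" using C(2) assms(2) by (auto simp: B_def)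
    then show ?thesis using partition_on_remove[OF assms(1), of C] C(1) by simp
  qed
  have BA: "B \<subseteq> A" using C(1) partition_onD1[OF assms(1)] by (auto simp: B_def)
  have B_notin: "B \<notin> Q - {C}"
  proof
    assume "B \<in> Q - {C}"
    then show False using partition_onD1[OF rest] partition_onD3[OF rest] by (cases "B = {}") auto
  qed
  show thesis
  proof (cases "B = {}")
    case True
    show thesis by (rule that[of "Q - {C}" B]) (use True rest B_notin insB C(1) in auto)
  next
    case False
    have "disjnt B (\<Union>(Q - {C}))" using partition_onD1[OF rest] by (auto simp: disjnt_def)
    then have "partition_on A (insert B (Q - {C}))"
      using rest BA False by (simp add: partition_on_insert)
    then show thesis by (rule that[of _ B]) (use B_notin insB C(1) in auto)
  qed
qed

text \<open>The pair \<open>(P, {})\<close> stands for the partition in which \<open>a\<close> forms a block of its own.\<close>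

lemma bij_betw_partition_on_insert:
  assumes "a \<notin> A"
  shows "bij_betw (\<lambda>(P, B). insert (insert a B) (P - {B}))
    (SIGMA P:{P. partition_on A P}. insert {} P) {Q. partition_on (insert a A) Q}"
  unfolding bij_betw_def
proof
  show "inj_on (\<lambda>(P, B). insert (insert a B) (P - {B}))
    (SIGMA P:{P. partition_on A P}. insert {} P)"
  proof (rule inj_onI, clarify, rule conjI)
    fix P B P' B'
    assume P: "partition_on A P" "B \<in> insert {} P" and P': "partition_on A P'" "B' \<in> insert {} P'"
      and eq: "insert (insert a B) (P - {B}) = insert (insert a B') (P' - {B'})"
    have a_notin: "a \<notin> E" if "E \<in> insert {} P \<union> insert {} P'" for E
      using that assms partition_onD1[OF P(1)] partition_onD1[OF P'(1)] by auto
    have "insert a B \<in> insert (insert a B') (P' - {B'})" unfolding eq[symmetric] by blast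
    then have "insert a B = insert a B'" using a_notin by blast
    moreover have "a \<notin> B" "a \<notin> B'" using a_notin P(2) P'(2) by blast+
    ultimately show "B = B'" by (simp add: insert_ident)
    moreover have "insert a B \<notin> P - {B}" "insert a B \<notin> P' - {B}" using a_notin by blast+
    ultimately have "P - {B} = P' - {B}" using eq by (simp add: insert_ident)
    then show "P = P'"
      using P(2) P'(2) \<open>B = B'\<close> partition_onD3[OF P(1)] partition_onD3[OF P'(1)] by blast
  qed
  show "(\<lambda>(P, B). insert (insert a B) (P - {B})) ` (SIGMA P:{P. partition_on A P}. insert {} P) =
    {Q. partition_on (insert a A) Q}" (is "?h ` ?D = _")
  proof (intro equalityI subsetI)
    fix Q assume "Q \<in> {Q. partition_on (insert a A) Q}"
    then obtain P B where "(P, B) \<in> ?D" "Q = ?h (P, B)"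
      using partition_on_insertE[OF _ assms]
      by (metis (no_types, lifting) SigmaI case_prod_conv mem_Collect_eq)
    then show "Q \<in> ?h ` ?D" by blast
  qed (use assms in \<open>auto intro: partition_on_insert_into_block\<close>)
qed

lemma sum_partition_on_insert:
  fixes f :: "'a set set \<Rightarrow> 'b::comm_monoid_add"
  assumes "finite A" "a \<notin> A"
  shows "(\<Sum>Q | partition_on (insert a A) Q. f Q) =
    (\<Sum>P | partition_on A P. \<Sum>B\<in>insert {} P. f (insert (insert a B) (P - {B})))"
proof -
  have "(\<Sum>Q | partition_on (insert a A) Q. f Q) =
      (\<Sum>(P, B)\<in>(SIGMA P:{P. partition_on A P}. insert {} P). f (insert (insert a B) (P - {B})))"
    using sum.reindex_bij_betw[OF bij_betw_partition_on_insert[OF assms(2)], of f]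
    by (simp add: split_beta)
  also have "\<dots> = (\<Sum>P | partition_on A P. \<Sum>B\<in>insert {} P. f (insert (insert a B) (P - {B})))"
    using assms(1) by (intro sum.Sigma[symmetric])
      (auto simp: finitely_many_partition_on finite_elements)
  finally show ?thesis .
qed

lemma sum_Pow_insert:
  assumes "finite A" "a \<notin> A"
  shows "(\<Sum>S\<in>Pow (insert a A). f S) = (\<Sum>S\<in>Pow A. f S + f (insert a S))"
proof -
  have "inj_on (insert a) (Pow A)" using assms(2)
    by (intro inj_onI) (metis PowD insert_ident subsetD)
  then have "(\<Sum>S\<in>Pow A. f (insert a S)) = sum f (insert a ` Pow A)" by (simp add: sum.reindex)
  moreover have "sum f (Pow (insert a A)) = sum f (Pow A) + sum f (insert a ` Pow A)"
    unfolding Pow_insert using assms by (intro sum.union_disjoint) auto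
  ultimately show ?thesis by (simp add: sum.distrib)
qed

lemma sum_Pow_remove_insert:
  fixes f :: "'a set \<Rightarrow> 'b::semiring_1"
  assumes "finite A"
  shows "(\<Sum>a\<in>A. \<Sum>S\<in>Pow (A - {a}). f (insert a S)) = (\<Sum>S\<in>Pow A. of_nat (card S) * f S)"
proof -
  have "(\<Sum>S\<in>Pow (A - {a}). f (insert a S)) = (\<Sum>S | S \<in> Pow A \<and> a \<in> S. f S)" if "a \<in> A" for a
    by (rule sum.reindex_bij_witness[of _ "\<lambda>S. S - {a}" "insert a"]) (use that in auto)
  then have "(\<Sum>a\<in>A. \<Sum>S\<in>Pow (A - {a}). f (insert a S)) = (\<Sum>a\<in>A. \<Sum>S | S \<in> Pow A \<and> a \<in> S. f S)"
    by simp
  also have "\<dots> = (\<Sum>S\<in>Pow A. \<Sum>a | a \<in> A \<and> a \<in> S. f S)"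
    using assms by (intro sum.swap_restrict) auto
  also have "\<dots> = (\<Sum>S\<in>Pow A. of_nat (card S) * f S)"
    by (intro sum.cong refl) (simp add: Int_absorb1 flip: Int_def)
  finally show ?thesis .
qed

lemma set_partitionsD:
  assumes "\<pi> \<in> set_partitions n"
  shows "finite \<pi>" and "{} \<notin> \<pi>" and "B \<in> \<pi> \<Longrightarrow> B \<subseteq> {1..n}"
  using assms finite_elements[of "{1..n}" \<pi>] unfolding set_partitions_def partition_on_def by auto

lemma set_partitions_0: "set_partitions 0 = {{}}"
  by (simp add: set_partitions_def partition_on_empty)

lemma insert_Suc_notin_set_partitions:
  assumes "\<pi> \<in> set_partitions n"
  shows "insert (Suc n) B \<notin> \<pi>"
  using set_partitionsD(3)[OF assms, of "insert (Suc n) B"] by auto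

lemma sum_set_partitions_Suc:
  "(\<Sum>\<pi>\<in>set_partitions (Suc n). f \<pi>) =
    (\<Sum>\<pi>\<in>set_partitions n. \<Sum>B\<in>insert {} \<pi>. f (insert (insert (Suc n) B) (\<pi> - {B})))"
proof -
  have "{1..Suc n} = insert (Suc n) {1..n}" by auto
  then show ?thesis
    unfolding set_partitions_def by (simp only:) (rule sum_partition_on_insert; simp)
qed

definition block_span :: "nat set \<Rightarrow> int" where
  "block_span B = int (Max B) - int (Min B) + 1"

text \<open>The dimension exponent of a partition of \<open>{1..n}\<close> whose blocks in \<open>S\<close> count as reaching up to
  \<open>n\<close>, because they are going to receive further elements.\<close>

definition open_dim :: "nat \<Rightarrow> nat set set \<Rightarrow> nat set set \<Rightarrow> int" where
  "open_dim n \<pi> S = (\<Sum>B\<in>\<pi> - S. block_span B) + (\<Sum>B\<in>S. int n - int (Min B) + 1) - int n"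

definition open_sum :: "nat \<Rightarrow> (int \<Rightarrow> nat \<Rightarrow> 'a::comm_monoid_add) \<Rightarrow> 'a" where
  "open_sum n g = (\<Sum>\<pi>\<in>set_partitions n. \<Sum>S\<in>Pow \<pi>. g (open_dim n \<pi> S) (card S))"

lemma open_sum_0: "open_sum 0 g = g 0 0"
  by (simp add: open_sum_def open_dim_def set_partitions_0)

lemma (in module_hom) open_sum: "f (open_sum n g) = open_sum n (\<lambda>d m. f (g d m))"
  by (simp add: open_sum_def sum)

lemma open_sum_sum: "open_sum n (\<lambda>d m. \<Sum>i\<in>I. g i d m) = (\<Sum>i\<in>I. open_sum n (g i))"
  unfolding open_sum_def by (rule trans[OF sum.cong[OF refl sum.swap] sum.swap])

lemma dim_moment_eq_open_sum:
  "dim_moment k n = open_sum n (\<lambda>d m. if m = 0 then d ^ k else 0)"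
  unfolding dim_moment_def open_sum_def
proof (rule sum.cong[OF refl])
  fix \<pi> assume "\<pi> \<in> set_partitions n"
  then have fin: "finite \<pi>" by (rule set_partitionsD)
  then have "(\<Sum>S\<in>Pow \<pi>. if card S = 0 then open_dim n \<pi> S ^ k else 0) =
      (\<Sum>S\<in>Pow \<pi>. if S = {} then open_dim n \<pi> S ^ k else 0)"
    by (intro sum.cong) (auto simp: finite_subset)
  also have "\<dots> = open_dim n \<pi> {} ^ k" using fin by (simp add: sum.delta)
  also have "open_dim n \<pi> {} = dim_exponent n \<pi>"
    by (simp add: open_dim_def dim_exponent_def block_span_def)
  finally show "dim_exponent n \<pi> ^ k = (\<Sum>S\<in>Pow \<pi>. if card S = 0 then open_dim n \<pi> S ^ k else 0)" ..
qed

lemma Min_insert_Suc: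
  assumes "B \<subseteq> {1..n}"
  shows "Min (insert (Suc n) B) = (if B = {} then Suc n else Min B)"
proof -
  have "finite B" using assms finite_subset by blast
  show ?thesis
  proof (cases "B = {}")
    case False
    have "Min B \<le> n" using Min_in[OF \<open>finite B\<close> False] assms by auto
    then show ?thesis using False \<open>finite B\<close> by simp
  qed simp
qed

lemma block_span_insert_Suc:
  assumes "B \<subseteq> {1..n}"
  shows "block_span (insert (Suc n) B) = int (Suc n) - int (Min (insert (Suc n) B)) + 1"
proof -
  have "finite B" using assms finite_subset by blast
  then have "Max (insert (Suc n) B) = Suc n" using assms by (intro Max_eqI) auto
  then show ?thesis by (simp add: block_span_def)
qed

text \<open>The new element may close its block or leave it open; up to time \<open>n\<close>, the block that it
  continues was open in either case.\<close>

lemma open_dim_insert_Suc: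
  fixes \<pi> n B
  defines "C \<equiv> insert (Suc n) B"
  assumes \<pi>: "\<pi> \<in> set_partitions n" and B: "B \<in> insert {} \<pi>" and S: "S \<subseteq> \<pi> - {B}"
  shows "open_dim (Suc n) (insert C (\<pi> - {B})) S = open_dim n \<pi> (insert B S - {{}}) + int (card S)"
    and "open_dim (Suc n) (insert C (\<pi> - {B})) (insert C S) =
      open_dim n \<pi> (insert B S - {{}}) + int (card S)"
proof -
  have fin: "finite \<pi>" "finite S" using set_partitionsD(1)[OF \<pi>] S finite_subset by auto
  have "B \<subseteq> {1..n}" using B set_partitionsD(3)[OF \<pi>] by auto
  note span_C = block_span_insert_Suc[OF this, folded C_def]
    and Min_C = Min_insert_Suc[OF this, folded C_def]
  have C: "C \<notin> \<pi>" using insert_Suc_notin_set_partitions[OF \<pi>] by (simp add: C_def)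
  have closed: "insert C (\<pi> - {B}) - S = insert C (\<pi> - {B} - S)"
    "insert C (\<pi> - {B}) - insert C S = \<pi> - {B} - S" "\<pi> - (insert B S - {{}}) = \<pi> - {B} - S"
    using C S set_partitionsD(2)[OF \<pi>] by auto
  have extend: "(\<Sum>E\<in>S. int (Suc n) - int (Min E) + 1) =
      (\<Sum>E\<in>S. int n - int (Min E) + 1) + int (card S)"
  proof -
    have "int (Suc n) - int (Min E) + 1 = (int n - int (Min E) + 1) + 1" for E by simp
    then show ?thesis by (simp only: sum.distrib) simp
  qed
  have opened: "(\<Sum>E\<in>insert B S - {{}}. int n - int (Min E) + 1) =
      (\<Sum>E\<in>S. int n - int (Min E) + 1) + (block_span C - 1)"
  proof (cases "B = {}")
    case True
    then have "insert B S - {{}} = S" using S by auto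
    then show ?thesis using True span_C Min_C by simp
  next
    case False
    then have "insert B S - {{}} = insert B S" "B \<notin> S" using S set_partitionsD(2)[OF \<pi>] by auto
    then show ?thesis using False span_C Min_C fin by simp
  qed
  show "open_dim (Suc n) (insert C (\<pi> - {B})) S = open_dim n \<pi> (insert B S - {{}}) + int (card S)"
    unfolding open_dim_def closed extend opened using C fin by simp
  have "C \<notin> S" using C S by blast
  then have "(\<Sum>E\<in>insert C S. int (Suc n) - int (Min E) + 1) =
      block_span C + (\<Sum>E\<in>S. int (Suc n) - int (Min E) + 1)"
    using fin span_C by simp
  then show "open_dim (Suc n) (insert C (\<pi> - {B})) (insert C S) =
      open_dim n \<pi> (insert B S - {{}}) + int (card S)"
    unfolding open_dim_def closed opened extend by simp
qed

lemma sum_Pow_insert_Suc: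
  fixes \<pi> n B
  defines "C \<equiv> insert (Suc n) B"
  assumes \<pi>: "\<pi> \<in> set_partitions n" and B: "B \<in> insert {} \<pi>"
  shows "(\<Sum>S\<in>Pow (insert C (\<pi> - {B})). g (open_dim (Suc n) (insert C (\<pi> - {B})) S) (card S)) =
    (\<Sum>S\<in>Pow (\<pi> - {B}).
      g (open_dim n \<pi> (insert B S - {{}}) + int (card S)) (card S) +
      g (open_dim n \<pi> (insert B S - {{}}) + int (card S)) (Suc (card S)))"
proof -
  have C: "C \<notin> \<pi> - {B}" using insert_Suc_notin_set_partitions[OF \<pi>] by (simp add: C_def)
  have fin: "finite (\<pi> - {B})" using set_partitionsD(1)[OF \<pi>] by simp
  have "card (insert C S) = Suc (card S)" if "S \<in> Pow (\<pi> - {B})" for S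
    using that C finite_subset[OF _ fin] by (subst card_insert_disjoint) auto
  then show ?thesis
    unfolding sum_Pow_insert[OF fin C]
    using open_dim_insert_Suc[OF \<pi> B, folded C_def] by (intro sum.cong refl) simp
qed

lemma open_sum_Suc:
  fixes g :: "int \<Rightarrow> nat \<Rightarrow> 'a::semiring_1"
  shows "open_sum (Suc n) g = open_sum n (\<lambda>d m.
    g (d + int m) m + g (d + int m) (Suc m) +
    of_nat m * (g (d + int m - 1) (m - 1) + g (d + int m - 1) m))"
  (is "_ = open_sum n (\<lambda>d m. ?new d m + of_nat m * ?old d m)")
  unfolding open_sum_def sum_set_partitions_Suc
proof (rule sum.cong[OF refl])
  fix \<pi> assume \<pi>: "\<pi> \<in> set_partitions n"
  note fin = set_partitionsD(1)[OF \<pi>] and ne = set_partitionsD(2)[OF \<pi>]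
  let ?F = "\<lambda>B. \<Sum>S\<in>Pow (insert (insert (Suc n) B) (\<pi> - {B})).
    g (open_dim (Suc n) (insert (insert (Suc n) B) (\<pi> - {B})) S) (card S)"
  have new: "?F {} = (\<Sum>S\<in>Pow \<pi>. ?new (open_dim n \<pi> S) (card S))"
  proof -
    have "insert {} S - {{}} = S" if "S \<in> Pow \<pi>" for S using that ne by auto
    then show ?thesis using ne sum_Pow_insert_Suc[OF \<pi>, of "{}" g] by simp
  qed
  have old: "?F B = (\<Sum>S\<in>Pow (\<pi> - {B}). ?old (open_dim n \<pi> (insert B S)) (card (insert B S)))"
    if B: "B \<in> \<pi>" for B
  proof -
    have "insert B S - {{}} = insert B S \<and> card (insert B S) = Suc (card S)"
      if "S \<in> Pow (\<pi> - {B})" for S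
    proof -
      have "{} \<notin> S" "B \<noteq> {}" "B \<notin> S" "finite S" using that B ne fin finite_subset by blast+
      then show ?thesis by simp
    qed
    then show ?thesis using B by (simp add: sum_Pow_insert_Suc[OF \<pi>] add_ac)
  qed
  have "(\<Sum>B\<in>insert {} \<pi>. ?F B) = ?F {} + (\<Sum>B\<in>\<pi>. ?F B)" using fin ne by simp
  also have "(\<Sum>B\<in>\<pi>. ?F B) =
      (\<Sum>B\<in>\<pi>. \<Sum>S\<in>Pow (\<pi> - {B}). ?old (open_dim n \<pi> (insert B S)) (card (insert B S)))"
    using old by (rule sum.cong[OF refl])
  also have "\<dots> = (\<Sum>S\<in>Pow \<pi>. of_nat (card S) * ?old (open_dim n \<pi> S) (card S))"
    by (rule sum_Pow_remove_insert[OF fin])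
  finally show "(\<Sum>B\<in>insert {} \<pi>. ?F B) =
      (\<Sum>S\<in>Pow \<pi>. ?new (open_dim n \<pi> S) (card S) + of_nat (card S) * ?old (open_dim n \<pi> S) (card S))"
    unfolding new by (simp add: sum.distrib)
qed

section \<open>The Bell functional and Charlier polynomials\<close>

interpretation poly_mod: module "smult :: 'a::comm_ring_1 \<Rightarrow> 'a poly \<Rightarrow> 'a poly"
  by unfold_locales (simp_all add: smult_add_left smult_add_right)

interpretation module_over_itself: module "(*) :: 'a::comm_ring_1 \<Rightarrow> 'a \<Rightarrow> 'a"
  by unfold_locales (simp_all add: algebra_simps)

declare module_over_itself.scale_scale [simp del]  \<comment> \<open>loops with \<open>mult.assoc\<close>\<close>

lemma (in module) module_hom_funpow: "module_hom scale scale f \<Longrightarrow> module_hom scale scale (f ^^ i)"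
  by (induction i)
    (simp_all add: module_hom_id module_hom_compose funpow_Suc_right del: funpow.simps(2))

definition \<xi> :: "'a::comm_ring_1 poly" where
  "\<xi> = [:0, 1:]"

definition raising :: "'a::comm_ring_1 poly \<Rightarrow> 'a poly" where
  "raising f = \<xi> * pcompose f [:-1, 1:]"

definition shifting :: "'a::comm_ring_1 poly \<Rightarrow> 'a poly" where
  "shifting f = pcompose f [:1, 1:]"

definition fwd_diff :: "'a::comm_ring_1 poly \<Rightarrow> 'a poly" where
  "fwd_diff f = shifting f - f"

interpretation raising: module_hom smult smult "raising :: 'a::comm_ring_1 poly \<Rightarrow> 'a poly"
  by unfold_locales (simp_all add: raising_def pcompose_add pcompose_smult algebra_simps)

interpretation shifting: module_hom smult smult "shifting :: 'a::comm_ring_1 poly \<Rightarrow> 'a poly"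
  by unfold_locales (simp_all add: shifting_def pcompose_add pcompose_smult)

interpretation fwd_diff: module_hom smult smult "fwd_diff :: 'a::comm_ring_1 poly \<Rightarrow> 'a poly"
  unfolding fwd_diff_def[abs_def]
  by unfold_locales (simp_all add: shifting.add shifting.scale smult_diff_right)

interpretation fwd_diff_funpow:
  module_hom smult smult "fwd_diff ^^ i :: 'a::comm_ring_1 poly \<Rightarrow> 'a poly" for i
  by (rule poly_mod.module_hom_funpow) unfold_locales

lemma fwd_diff_1 [simp]: "fwd_diff 1 = 0"
  by (simp add: fwd_diff_def shifting_def pcompose_1)

lemma raising_shifting: "raising (shifting f) = \<xi> * f"
  by (simp add: raising_def shifting_def pcompose_pCons flip: pcompose_assoc)

lemma shifting_mult_\<xi>: "shifting (\<xi> * f) = \<xi> * shifting f + shifting f"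
  by (simp add: shifting_def \<xi>_def pcompose_mult pcompose_pCons)

lemma raising_mult_\<xi>: "raising (\<xi> * f) = \<xi> * raising f - raising f"
  by (simp add: raising_def \<xi>_def pcompose_mult pcompose_pCons)

lemma shifting_raising: "shifting (raising f) = \<xi> * f + f"
  by (simp add: raising_def shifting_def \<xi>_def pcompose_mult pcompose_pCons flip: pcompose_assoc)

lemma fwd_diff_raising: "fwd_diff (raising f) = raising (fwd_diff f) + f"
  by (simp add: fwd_diff_def raising.diff raising_shifting shifting_raising)

lemma fwd_diff_funpow_raising:
  "(fwd_diff ^^ Suc i) (raising f) =
    raising ((fwd_diff ^^ Suc i) f) + smult (of_nat (Suc i)) ((fwd_diff ^^ i) f)"
proof (induction i)
  case (Suc i)
  have "(fwd_diff ^^ Suc (Suc i)) (raising f) =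
      fwd_diff (raising ((fwd_diff ^^ Suc i) f) + smult (of_nat (Suc i)) ((fwd_diff ^^ i) f))"
    using Suc by simp
  also have "\<dots> = raising ((fwd_diff ^^ Suc (Suc i)) f) + (fwd_diff ^^ Suc i) f +
      smult (of_nat (Suc i)) ((fwd_diff ^^ Suc i) f)"
    by (simp add: fwd_diff.add fwd_diff.scale fwd_diff_raising)
  also have "\<dots> = raising ((fwd_diff ^^ Suc (Suc i)) f) +
      smult (of_nat (Suc (Suc i))) ((fwd_diff ^^ Suc i) f)"
    unfolding of_nat_Suc[of "Suc i"] smult_add_left by simp
  finally show ?case .
qed (simp add: fwd_diff_raising)

lemma degree_shifting [simp]: "degree (shifting f) = degree (f :: 'a::idom poly)"
  by (simp add: shifting_def degree_pcompose)

lemma degree_raising_le: "degree (raising f) \<le> Suc (degree f)"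
  unfolding raising_def \<xi>_def using degree_mult_le degree_pcompose_le[of f "[:-1, 1:]"]
  by (simp add: degree_pCons_eq_if) 

lemma degree_fwd_diff_less:
  fixes f :: "'a::idom poly"
  assumes "fwd_diff f \<noteq> 0"
  shows "degree (fwd_diff f) < degree f"
proof -
  have "lead_coeff (shifting f) = lead_coeff f"
    unfolding shifting_def by (subst lead_coeff_comp) auto
  then have "coeff (fwd_diff f) (degree f) = 0" by (simp add: fwd_diff_def)
  moreover have "degree (fwd_diff f) \<le> degree f"
    unfolding fwd_diff_def by (intro degree_diff_le) simp_all
  ultimately show ?thesis using assms by (metis le_neq_implies_less leading_coeff_0_iff)
qed

lemma fwd_diff_funpow_eq_0:
  fixes f :: "'a::idom poly"
  shows "degree f < i \<Longrightarrow> (fwd_diff ^^ i) f = 0"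
proof (induction i arbitrary: f)
  case (Suc i)
  show ?case
  proof (cases "fwd_diff f = 0")
    case False
    then have "degree (fwd_diff f) < i" using degree_fwd_diff_less[of f] Suc.prems by simp
    then show ?thesis using Suc.IH by (simp add: funpow_Suc_right del: funpow.simps)
  qed (simp add: funpow_Suc_right del: funpow.simps)
qed simp

text \<open>Newton's forward difference formula expands \<open>f\<close> in falling factorials; \<open>bell_functional\<close> sends
  each of them to \<open>1\<close>.\<close>

definition bell_functional :: "'a::field_char_0 poly \<Rightarrow> 'a" where
  "bell_functional f = (\<Sum>i\<le>degree f. poly ((fwd_diff ^^ i) f) 0 / fact i)"

lemma bell_functional_eq:
  "degree f \<le> N \<Longrightarrow> bell_functional f = (\<Sum>i\<le>N. poly ((fwd_diff ^^ i) f) 0 / fact i)"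
  unfolding bell_functional_def by (intro sum.mono_neutral_left) (auto simp: fwd_diff_funpow_eq_0)

interpretation bell_functional:
  module_hom smult "(*)" "bell_functional :: 'a::field_char_0 poly \<Rightarrow> 'a"
proof unfold_locales
  fix f g :: "'a poly" and c :: 'a
  define N where "N = max (degree f) (degree g)"
  have "degree f \<le> N" "degree g \<le> N" "degree (f + g) \<le> N"
    by (simp_all add: N_def degree_add_le_max)
  then show "bell_functional (f + g) = bell_functional f + bell_functional g"
    by (simp add: bell_functional_eq[of _ N] fwd_diff_funpow.add add_divide_distrib sum.distrib)
  have "degree (smult c f) \<le> degree f" by simp
  then show "bell_functional (smult c f) = c * bell_functional f"
    by (simp add: bell_functional_eq[of _ "degree f"] fwd_diff_funpow.scale sum_distrib_left)
qed

lemma bell_functional_1 [simp]: "bell_functional 1 = 1"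
  by (simp add: bell_functional_def)

lemma bell_functional_raising [simp]: "bell_functional (raising f) = bell_functional f"
proof -
  have "bell_functional (raising f) =
      (\<Sum>i\<le>Suc (degree f). poly ((fwd_diff ^^ i) (raising f)) 0 / fact i)"
    by (rule bell_functional_eq[OF degree_raising_le])
  also have "\<dots> = (\<Sum>i\<le>degree f. poly ((fwd_diff ^^ Suc i) (raising f)) 0 / fact (Suc i))"
    by (simp only: sum.atMost_Suc_shift) (simp add: raising_def \<xi>_def)
  also have "\<dots> = (\<Sum>i\<le>degree f. of_nat (Suc i) * poly ((fwd_diff ^^ i) f) 0 / fact (Suc i))"
    unfolding fwd_diff_funpow_raising by (simp add: raising_def \<xi>_def del: of_nat_Suc)
  also have "\<dots> = bell_functional f"
    unfolding bell_functional_def by (intro sum.cong refl) (simp del: of_nat_Suc)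
  finally show ?thesis .
qed

lemma bell_functional_shifting: "bell_functional (shifting f) = bell_functional (\<xi> * f)"
  using bell_functional_raising[of "shifting f"] by (simp add: raising_shifting)

fun charlier :: "nat \<Rightarrow> 'a::comm_ring_1 poly" where
  "charlier 0 = 1"
| "charlier (Suc m) = raising (charlier m) - charlier m"

declare charlier.simps(2) [simp del]

lemma bell_functional_charlier: "bell_functional (charlier m) = (if m = 0 then 1 else 0)"
  by (cases m) (simp_all add: charlier.simps(2) bell_functional.diff)

lemma raising_charlier: "raising (charlier m) = charlier (Suc m) + charlier m"
  by (simp add: charlier.simps(2))

lemma fwd_diff_charlier:
  "fwd_diff (charlier m) = smult (of_nat m) (charlier (m - 1) :: 'a::comm_ring_1 poly)"
proof (induction m)
  case (Suc m)
  have "fwd_diff (charlier (Suc m) :: 'a poly) =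
      smult (of_nat m) (raising (charlier (m - 1)) - charlier (m - 1)) + charlier m"
    by (simp add: charlier.simps(2) fwd_diff.diff fwd_diff_raising Suc raising.scale
        smult_diff_right)
  also have "smult (of_nat m) (raising (charlier (m - 1)) - charlier (m - 1)) =
      smult (of_nat m) (charlier m :: 'a poly)"
    by (cases m) (simp_all add: raising_charlier)
  also have "smult (of_nat m) (charlier m) + charlier m =
      smult (of_nat (Suc m)) (charlier m :: 'a poly)"
    by (simp add: smult_add_left)
  finally show ?case by simp
qed simp

definition number_op :: "'a::comm_ring_1 poly \<Rightarrow> 'a poly" where
  "number_op f = raising (fwd_diff f) - fwd_diff f"

interpretation number_op: module_hom smult smult "number_op :: 'a::comm_ring_1 poly \<Rightarrow> 'a poly"
  by unfold_locales
    (simp_all add: number_op_def fwd_diff.add fwd_diff.scale raising.add raising.scale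
      smult_diff_right)

interpretation number_op_funpow:
  module_hom smult smult "number_op ^^ j :: 'a::comm_ring_1 poly \<Rightarrow> 'a poly" for j
  by (rule poly_mod.module_hom_funpow) unfold_locales

lemma number_op_charlier: "number_op (charlier m) = smult (of_nat m) (charlier m)"
  by (cases m) (simp_all add: number_op_def fwd_diff_charlier raising.scale raising_charlier
      smult_add_right)

lemma number_op_funpow_charlier: "(number_op ^^ j) (charlier m) = smult (of_nat m ^ j) (charlier m)"
  by (induction j) (simp_all add: number_op.scale number_op_charlier mult.commute)

definition step_op :: "nat \<Rightarrow> 'a::comm_ring_1 poly \<Rightarrow> 'a poly" where
  "step_op j f = raising ((number_op ^^ j) (shifting f))"

interpretation step_op: module_hom smult smult "step_op j :: 'a::comm_ring_1 poly \<Rightarrow> 'a poly" for j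
  by unfold_locales
    (simp_all add: step_op_def raising.add raising.scale shifting.add shifting.scale
      number_op_funpow.add number_op_funpow.scale)

lemma step_op_0: "step_op 0 f = \<xi> * f"
  by (simp add: step_op_def raising_shifting)

lemma step_op_charlier:
  "step_op j (charlier m :: 'a::comm_ring_1 poly) =
    smult (of_nat m ^ j) (charlier (Suc m) + charlier m) +
    smult (of_nat m * (of_nat m - 1) ^ j) (charlier m + charlier (m - 1))"
proof -
  have "shifting (charlier m :: 'a poly) = charlier m + smult (of_nat m) (charlier (m - 1))"
    using fwd_diff_charlier[of m] by (simp add: fwd_diff_def algebra_simps)
  then have "step_op j (charlier m :: 'a poly) = smult (of_nat m ^ j) (raising (charlier m)) +
      smult (of_nat m * of_nat (m - 1) ^ j) (raising (charlier (m - 1)))"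
    by (simp add: step_op_def number_op_funpow.add number_op_funpow.scale number_op_funpow_charlier
        raising.add raising.scale)
  also have "smult (of_nat m * of_nat (m - 1) ^ j) (raising (charlier (m - 1))) =
      smult (of_nat m * (of_nat m - 1) ^ j) (charlier m + charlier (m - 1) :: 'a poly)"
    by (cases m) (simp_all add: raising_charlier)
  finally show ?thesis by (simp add: raising_charlier)
qed

definition moment_poly :: "nat \<Rightarrow> nat \<Rightarrow> 'a::comm_ring_1 poly" where
  "moment_poly k n = open_sum n (\<lambda>d m. smult (of_int d ^ k) (charlier m))"

lemma bell_functional_moment_poly: "bell_functional (moment_poly k n) = of_int (dim_moment k n)"
proof -
  have "bell_functional (moment_poly k n) =
      open_sum n (\<lambda>d m. if m = 0 then of_int d ^ k else 0 :: 'a)"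
    by (simp add: moment_poly_def bell_functional.open_sum bell_functional.scale
        bell_functional_charlier if_distrib cong: if_cong)
  also have "\<dots> = of_int (dim_moment k n)"
    unfolding dim_moment_eq_open_sum open_sum_def of_int_sum by (intro sum.cong refl) simp
  finally show ?thesis .
qed

lemma moment_poly_0: "moment_poly k 0 = (if k = 0 then 1 else 0)"
  by (cases k) (simp_all add: moment_poly_def open_sum_0)

lemma sum_binomial_step_op_charlier:
  fixes d :: "'a::comm_ring_1"
  shows "(\<Sum>j\<le>k. smult (of_nat (k choose j) * d ^ (k - j)) (step_op j (charlier m))) =
    smult ((d + of_nat m) ^ k) (charlier m) + smult ((d + of_nat m) ^ k) (charlier (Suc m)) +
    of_nat m * (smult ((d + of_nat m - 1) ^ k) (charlier (m - 1)) +
      smult ((d + of_nat m - 1) ^ k) (charlier m))"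
proof -
  have "(\<Sum>j\<le>k. smult (of_nat (k choose j) * d ^ (k - j)) (step_op j (charlier m))) =
      smult (\<Sum>j\<le>k. of_nat (k choose j) * of_nat m ^ j * d ^ (k - j))
        (charlier (Suc m) + charlier m) +
      smult (of_nat m * (\<Sum>j\<le>k. of_nat (k choose j) * (of_nat m - 1) ^ j * d ^ (k - j)))
        (charlier m + charlier (m - 1))"
    unfolding step_op_charlier
    by (simp add: smult_add_right sum.distrib smult_sum sum_distrib_left mult_ac)
  also have "\<dots> = smult ((of_nat m + d) ^ k) (charlier (Suc m) + charlier m) +
      smult (of_nat m * ((of_nat m - 1) + d) ^ k) (charlier m + charlier (m - 1))"
    by (simp only: binomial_ring)
  finally show ?thesis
    by (simp add: of_nat_poly smult_add_right algebra_simps)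
qed

lemma moment_poly_Suc:
  "moment_poly k (Suc n) =
    (\<Sum>j\<le>k. smult (of_nat (k choose j)) (step_op j (moment_poly (k - j) n)))"
proof -
  have "moment_poly k (Suc n) = open_sum n (\<lambda>d m. \<Sum>j\<le>k.
      smult (of_nat (k choose j) * of_int d ^ (k - j)) (step_op j (charlier m)))"
    unfolding moment_poly_def open_sum_Suc sum_binomial_step_op_charlier by simp
  also have "\<dots> = (\<Sum>j\<le>k. smult (of_nat (k choose j)) (step_op j (moment_poly (k - j) n)))"
    by (simp add: open_sum_sum moment_poly_def step_op.open_sum step_op.scale
        module_hom.open_sum[OF poly_mod.module_hom_scale_self])
  finally show ?thesis .
qed

lemma moment_poly_zero: "moment_poly 0 n = \<xi> ^ n"
  by (induction n) (simp_all add: moment_poly_0 moment_poly_Suc step_op_0)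

lemma bell_functional_power: "bell_functional (\<xi> ^ n) = of_nat (bell n)"
  using bell_functional_moment_poly[of 0 n]
  by (simp add: moment_poly_zero dim_moment_def bell_def)

section \<open>Solving the moment recurrence\<close>

definition seq_scale :: "('a \<Rightarrow> 'b \<Rightarrow> 'b) \<Rightarrow> 'a \<Rightarrow> (nat \<Rightarrow> 'b) \<Rightarrow> nat \<Rightarrow> 'b" where
  "seq_scale s c f = (\<lambda>n. s c (f n))"

lemma seq_scale_apply: "seq_scale s c f n = s c (f n)"
  by (simp add: seq_scale_def)

lemma sum_fun_apply [simp]: "(\<Sum>i\<in>I. f i) x = (\<Sum>i\<in>I. f i x)"
  by (induction I rule: infinite_finite_induct) simp_all

lemma (in module) module_seq_scale: "module (seq_scale scale)"
  by unfold_locales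
    (simp_all add: fun_eq_iff seq_scale_apply scale_left_distrib scale_right_distrib)

lemma (in module_hom) module_hom_comp_seq: "module_hom (seq_scale s1) (seq_scale s2) ((\<circ>) f)"
  by (intro module_hom.intro module_hom_axioms.intro m1.module_seq_scale m2.module_seq_scale)
    (simp_all add: fun_eq_iff seq_scale_apply add scale)

interpretation poly_seq: module
  "seq_scale smult :: 'a::comm_ring_1 \<Rightarrow> (nat \<Rightarrow> 'a poly) \<Rightarrow> nat \<Rightarrow> 'a poly"
  by (rule poly_mod.module_seq_scale)

interpretation mult_\<xi>: module_hom smult smult "(*) \<xi> :: 'a::comm_ring_1 poly \<Rightarrow> 'a poly"
  by unfold_locales (simp_all add: algebra_simps)

interpretation raising_seq: module_hom "seq_scale smult" "seq_scale smult"
  "(\<circ>) raising :: (nat \<Rightarrow> 'a::comm_ring_1 poly) \<Rightarrow> nat \<Rightarrow> 'a poly"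
  by (rule raising.module_hom_comp_seq)

interpretation shifting_seq: module_hom "seq_scale smult" "seq_scale smult"
  "(\<circ>) shifting :: (nat \<Rightarrow> 'a::comm_ring_1 poly) \<Rightarrow> nat \<Rightarrow> 'a poly"
  by (rule shifting.module_hom_comp_seq)

interpretation mult_\<xi>_seq: module_hom "seq_scale smult" "seq_scale smult"
  "(\<circ>) ((*) \<xi>) :: (nat \<Rightarrow> 'a::comm_ring_1 poly) \<Rightarrow> nat \<Rightarrow> 'a poly"
  by (rule mult_\<xi>.module_hom_comp_seq)

text \<open>The index \<open>b\<close> counts applications of \<^const>\<open>raising\<close>; since \<open>raising \<circ> shifting\<close> is multiplication
  by \<open>\<xi>\<close>, iterates of \<^const>\<open>shifting\<close> take the place of negative powers.\<close>

definition ladder :: "int \<Rightarrow> 'a::comm_ring_1 poly \<Rightarrow> 'a poly" where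
  "ladder b f = (if b \<ge> 0 then (raising ^^ nat b) f else (shifting ^^ nat (- b)) f)"

lemma ladder_0 [simp]: "ladder 0 f = f"
  by (simp add: ladder_def)

lemma raising_ladder:
  "raising (ladder b f) = (if b \<ge> 0 then ladder (b + 1) f else \<xi> * ladder (b + 1) f)"
proof (cases "b \<ge> 0")
  case True
  then have "nat (b + 1) = Suc (nat b)" by simp
  then show ?thesis using True by (simp add: ladder_def)
next
  case False
  then have "nat (- b) = Suc (nat (- (b + 1)))" by simp
  then show ?thesis using False by (auto simp: ladder_def raising_shifting)
qed

lemma shifting_ladder:
  "shifting (ladder b f) = (if b \<le> 0 then ladder (b - 1) f
    else \<xi> * ladder (b - 1) f + ladder (b - 1) f)"
proof (cases "b \<le> 0")
  case True
  then have "nat (- (b - 1)) = Suc (nat (- b))" by simp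
  then show ?thesis using True by (cases "b = 0") (simp_all add: ladder_def)
next
  case False
  then have "nat b = Suc (nat (b - 1))" by simp
  then show ?thesis using False by (simp add: ladder_def shifting_raising)
qed

lemma mult_\<xi>_raising_funpow:
  "\<xi> * (raising ^^ m) f = (raising ^^ m) (\<xi> * f) + smult (of_nat m) ((raising ^^ m) f)"
proof (induction m)
  case (Suc m)
  have "\<xi> * (raising ^^ Suc m) f = raising (\<xi> * (raising ^^ m) f) + (raising ^^ Suc m) f"
    by (simp add: raising_mult_\<xi>)
  then show ?case unfolding Suc by (simp add: raising.add raising.scale smult_add_left)
qed simp

lemma mult_\<xi>_shifting_funpow:
  "\<xi> * (shifting ^^ m) f = (shifting ^^ m) (\<xi> * f) - smult (of_nat m) ((shifting ^^ m) f)"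
proof (induction m)
  case (Suc m)
  have "\<xi> * (shifting ^^ Suc m) f = shifting (\<xi> * (shifting ^^ m) f) - (shifting ^^ Suc m) f"
    by (simp add: shifting_mult_\<xi>)
  then show ?case unfolding Suc by (simp add: shifting.diff shifting.scale smult_add_left)
qed simp

lemma mult_\<xi>_ladder: "\<xi> * ladder b f = ladder b (\<xi> * f) + smult (of_int b) (ladder b f)"
  by (simp add: ladder_def mult_\<xi>_raising_funpow mult_\<xi>_shifting_funpow)

lemma degree_ladder_le: "degree (ladder b f) \<le> nat \<bar>b\<bar> + degree (f :: 'a::idom poly)"
proof -
  have "degree ((raising ^^ m) f) \<le> m + degree f" for m
  proof (induction m)
    case (Suc m)
    then show ?case using degree_raising_le[of "(raising ^^ m) f"] by simp
  qed simp
  moreover have "degree ((shifting ^^ m) f) = degree f" for m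
    by (induction m) simp_all
  ultimately show ?thesis by (simp add: ladder_def)
qed

definition ladder_seq :: "int \<Rightarrow> nat \<Rightarrow> nat \<Rightarrow> nat \<Rightarrow> 'a::comm_ring_1 poly" where
  "ladder_seq b e i n = smult (of_nat n ^ e) (ladder b (\<xi> ^ (n + i)))"

lemma mult_\<xi>_ladder_seq:
  "(*) \<xi> \<circ> ladder_seq b e i =
    ladder_seq b e (Suc i) + seq_scale smult (of_int b) (ladder_seq b e i)"
  by (simp add: fun_eq_iff seq_scale_apply ladder_seq_def mult_\<xi>_ladder smult_add_right
      mult.commute)

lemma raising_ladder_seq:
  "raising \<circ> ladder_seq b e i = (if b \<ge> 0 then ladder_seq (b + 1) e i else
    ladder_seq (b + 1) e (Suc i) + seq_scale smult (of_int (b + 1)) (ladder_seq (b + 1) e i))"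
  unfolding mult_\<xi>_ladder_seq[symmetric]
  by (simp add: fun_eq_iff seq_scale_apply ladder_seq_def raising.scale raising_ladder)

lemma shifting_ladder_seq:
  "shifting \<circ> ladder_seq b e i = (if b \<le> 0 then ladder_seq (b - 1) e i else
    ladder_seq (b - 1) e (Suc i) + seq_scale smult (of_int b) (ladder_seq (b - 1) e i))"
proof -
  have "shifting \<circ> ladder_seq b e i = (if b \<le> 0 then ladder_seq (b - 1) e i else
      ((*) \<xi> \<circ> ladder_seq (b - 1) e i) + ladder_seq (b - 1) e i)"
    by (simp add: fun_eq_iff seq_scale_apply ladder_seq_def shifting.scale shifting_ladder
        smult_add_right)
  then show ?thesis
    unfolding mult_\<xi>_ladder_seq
    by (cases "b \<le> 0") (simp_all add: fun_eq_iff seq_scale_apply smult_diff_left)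
qed

definition ladder_span :: "(int \<Rightarrow> nat \<Rightarrow> nat \<Rightarrow> bool) \<Rightarrow> (nat \<Rightarrow> 'a::comm_ring_1 poly) set" where
  "ladder_span R = poly_seq.span {ladder_seq b e i | b e i. R b e i}"

lemma subspace_ladder_span: "poly_seq.subspace (ladder_span R)"
  by (simp add: ladder_span_def)

lemma ladder_seq_in_ladder_span: "R b e i \<Longrightarrow> ladder_seq b e i \<in> ladder_span R"
  unfolding ladder_span_def by (rule poly_seq.span_base) blast

lemmas ladder_span_intros =
  poly_seq.subspace_add[OF subspace_ladder_span] poly_seq.subspace_diff[OF subspace_ladder_span]
  poly_seq.subspace_scale[OF subspace_ladder_span] poly_seq.subspace_sum[OF subspace_ladder_span]
  ladder_seq_in_ladder_span

lemma ladder_span_image: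
  assumes "module_hom (seq_scale smult) s \<Phi>" "module.subspace s V" "f \<in> ladder_span R"
    and "\<And>b e i. R b e i \<Longrightarrow> \<Phi> (ladder_seq b e i) \<in> V"
  shows "\<Phi> f \<in> V"
proof -
  have "f \<in> poly_seq.span {ladder_seq b e i | b e i. R b e i}"
    using assms(3) by (simp add: ladder_span_def)
  then show ?thesis
    by (rule poly_seq.span_induct[OF _ module_hom.subspace_linear_preimage[OF assms(1,2)]])
      (use assms(4) in blast)
qed

lemma ladder_span_mono:
  assumes "f \<in> ladder_span R" "\<And>b e i. R b e i \<Longrightarrow> R' b e i"
  shows "f \<in> ladder_span R'"
  using poly_seq.module_hom_ident subspace_ladder_span assms(1)
  by (rule ladder_span_image) (intro ladder_seq_in_ladder_span assms(2))

definition bounded_index :: "nat \<Rightarrow> nat \<Rightarrow> int \<Rightarrow> nat \<Rightarrow> nat \<Rightarrow> bool" where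
  "bounded_index A w b e i \<longleftrightarrow> nat \<bar>b\<bar> + e + i \<le> A \<and> 2 * e \<le> w + i"

abbreviation bounded_span :: "nat \<Rightarrow> nat \<Rightarrow> (nat \<Rightarrow> 'a::comm_ring_1 poly) set" where
  "bounded_span A w \<equiv> ladder_span (bounded_index A w)"

lemma mult_\<xi>_in_bounded_span:
  assumes "f \<in> bounded_span A w"
  shows "(*) \<xi> \<circ> f \<in> bounded_span (Suc A) w"
  using mult_\<xi>_seq.module_hom_axioms subspace_ladder_span assms
proof (rule ladder_span_image)
  fix b e i assume "bounded_index A w b e i"
  then show "(*) \<xi> \<circ> ladder_seq b e i \<in> bounded_span (Suc A) w"
    unfolding mult_\<xi>_ladder_seq by (intro ladder_span_intros) (auto simp: bounded_index_def)
qed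

lemma raising_in_bounded_span:
  assumes "f \<in> bounded_span A w"
  shows "raising \<circ> f \<in> bounded_span (Suc A) w"
  using raising_seq.module_hom_axioms subspace_ladder_span assms
proof (rule ladder_span_image)
  fix b e i assume "bounded_index A w b e i"
  then show "raising \<circ> ladder_seq b e i \<in> bounded_span (Suc A) w"
    unfolding raising_ladder_seq
    by (cases "b \<ge> 0"; simp only: if_True if_False simp_thms; intro ladder_span_intros)
      (auto simp: bounded_index_def)
qed

lemma shifting_in_bounded_span:
  assumes "f \<in> bounded_span A w"
  shows "shifting \<circ> f \<in> bounded_span (Suc A) w"
  using shifting_seq.module_hom_axioms subspace_ladder_span assms
proof (rule ladder_span_image)
  fix b e i assume "bounded_index A w b e i"
  then show "shifting \<circ> ladder_seq b e i \<in> bounded_span (Suc A) w"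
    unfolding shifting_ladder_seq
    by (cases "b \<le> 0"; simp only: if_True if_False simp_thms; intro ladder_span_intros)
      (auto simp: bounded_index_def)
qed

lemma number_op_altdef: "number_op f = \<xi> * f - raising f - shifting f + f"
  by (simp add: number_op_def fwd_diff_def raising.diff raising_shifting)

lemma number_op_in_bounded_span:
  assumes "f \<in> bounded_span A w"
  shows "number_op \<circ> f \<in> bounded_span (Suc A) w"
proof -
  have "number_op \<circ> f = ((*) \<xi> \<circ> f) - (raising \<circ> f) - (shifting \<circ> f) + f"
    by (simp add: fun_eq_iff number_op_altdef)
  moreover have "f \<in> bounded_span (Suc A) w"
    by (rule ladder_span_mono[OF assms]) (auto simp: bounded_index_def)
  ultimately show ?thesis
    using mult_\<xi>_in_bounded_span[OF assms] raising_in_bounded_span[OF assms]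
      shifting_in_bounded_span[OF assms]
    by (simp only: ladder_span_intros(1,2))
qed

lemma number_op_funpow_in_bounded_span:
  "f \<in> bounded_span A w \<Longrightarrow> (number_op ^^ j) \<circ> f \<in> bounded_span (A + j) w"
proof (induction j)
  case (Suc j)
  have "(number_op ^^ Suc j) \<circ> f = number_op \<circ> ((number_op ^^ j) \<circ> f)" by (simp add: fun_eq_iff)
  then show ?case
    using number_op_in_bounded_span[OF Suc.IH[OF Suc.prems]] by (simp only: add_Suc_right)
qed simp

text \<open>At \<open>b = 0\<close> the recurrence is resonant: there its solution gains a power of \<open>n\<close> and loses a
  power of \<open>\<xi>\<close>. This needs \<open>i \<ge> 1\<close> and raises \<open>2e - i\<close> by \<open>3\<close>, which is why the bound for \<open>b = 0\<close>
  differs from the one for \<open>b \<noteq> 0\<close>.\<close>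

definition source_index :: "nat \<Rightarrow> int \<Rightarrow> nat \<Rightarrow> nat \<Rightarrow> bool" where
  "source_index k b e i \<longleftrightarrow> nat \<bar>b\<bar> + e + i \<le> 2 * k \<and>
    (if b = 0 then 2 * e + 3 \<le> k + i \<and> 1 \<le> i else 2 * e < k + i)"

definition moment_index :: "nat \<Rightarrow> int \<Rightarrow> nat \<Rightarrow> nat \<Rightarrow> bool" where
  "moment_index k b e i \<longleftrightarrow> nat \<bar>b\<bar> + e + i \<le> 2 * k \<and>
    (if b = 0 then 2 * e \<le> k + i else 2 * e < k + i)"

abbreviation source_span :: "nat \<Rightarrow> (nat \<Rightarrow> 'a::comm_ring_1 poly) set" where
  "source_span k \<equiv> ladder_span (source_index k)"

abbreviation moment_span :: "nat \<Rightarrow> (nat \<Rightarrow> 'a::comm_ring_1 poly) set" where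
  "moment_span k \<equiv> ladder_span (moment_index k)"

lemma raising_in_source_span:
  fixes f :: "nat \<Rightarrow> 'a::comm_ring_1 poly"
  assumes "f \<in> bounded_span (2 * k + 3) k"
  shows "raising \<circ> f \<in> source_span (k + 2)"
  using raising_seq.module_hom_axioms subspace_ladder_span assms
proof (rule ladder_span_image)
  fix b e i assume bound: "bounded_index (2 * k + 3) k b e i"
  consider "b \<ge> 0" | "b = -1" | "b < -1" by linarith
  then show "raising \<circ> (ladder_seq b e i :: nat \<Rightarrow> 'a poly) \<in> source_span (k + 2)"
  proof cases
    case 2
    then have "raising \<circ> ladder_seq b e i = (ladder_seq 0 e (Suc i) :: nat \<Rightarrow> 'a poly)"
      by (simp add: raising_ladder_seq)
    moreover have "source_index (k + 2) 0 e (Suc i)"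
      using bound 2 by (simp add: bounded_index_def source_index_def)
    ultimately show ?thesis by (simp only: ladder_seq_in_ladder_span)
  qed (use bound in \<open>auto simp: raising_ladder_seq bounded_index_def source_index_def
      intro!: ladder_span_intros\<close>)
qed

lemma step_op_in_source_span:
  assumes "f \<in> moment_span k" "2 \<le> j"
  shows "step_op j \<circ> f \<in> source_span (k + j)"
proof -
  have "f \<in> bounded_span (2 * k) k"
    by (rule ladder_span_mono[OF assms(1)])
      (auto simp: moment_index_def bounded_index_def split: if_splits)
  from number_op_funpow_in_bounded_span[OF shifting_in_bounded_span[OF this], of j]
  have "(number_op ^^ j) \<circ> (shifting \<circ> f) \<in> bounded_span (2 * (k + j - 2) + 3) (k + j - 2)"
    by (rule ladder_span_mono) (use assms(2) in \<open>auto simp: bounded_index_def\<close>)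
  from raising_in_source_span[OF this] have
    "raising \<circ> ((number_op ^^ j) \<circ> (shifting \<circ> f)) \<in> source_span (k + j)"
    using assms(2) by (simp only: le_add_diff_inverse2 trans_le_add2)
  then show ?thesis by (simp add: step_op_def[abs_def] comp_def)
qed

lemma step_op_1: "step_op 1 f = \<xi> * (\<xi> * f) - raising (\<xi> * f) - \<xi> * shifting f"
  by (simp add: step_op_def number_op_altdef raising.add raising.diff raising_mult_\<xi>
      raising_shifting)

lemma mult_\<xi>_mult_\<xi>_in_source_span:
  assumes "moment_index k b e i"
  shows "(*) \<xi> \<circ> ((*) \<xi> \<circ> ladder_seq b e i) \<in> source_span (Suc k)"
  unfolding mult_\<xi>_ladder_seq mult_\<xi>_seq.add mult_\<xi>_seq.scale
  by (cases "b = 0")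
    (use assms in \<open>auto simp: moment_index_def source_index_def intro!: ladder_span_intros\<close>)

lemma raising_mult_\<xi>_in_source_span:
  assumes "moment_index k b e i"
  shows "raising \<circ> ((*) \<xi> \<circ> ladder_seq b e i) \<in> source_span (Suc k)"
proof -
  consider "b = 0" | "b > 0" | "b = -1" | "b < -1" by linarith
  then show ?thesis
    unfolding mult_\<xi>_ladder_seq raising_seq.add raising_seq.scale raising_ladder_seq
    by cases
      (use assms in \<open>auto simp: moment_index_def source_index_def intro!: ladder_span_intros\<close>)
qed

lemma mult_\<xi>_shifting_in_source_span:
  assumes "moment_index k b e i"
  shows "(*) \<xi> \<circ> (shifting \<circ> ladder_seq b e i) \<in> source_span (Suc k)"
proof -
  consider "b = 0" | "b < 0" | "b = 1" | "b > 1" by linarith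
  then show ?thesis
    unfolding shifting_ladder_seq
    by cases (use assms in \<open>auto simp: mult_\<xi>_seq.add mult_\<xi>_seq.scale mult_\<xi>_ladder_seq
      moment_index_def source_index_def intro!: ladder_span_intros\<close>)
qed

lemma step_op_1_in_source_span:
  fixes f :: "nat \<Rightarrow> 'a::comm_ring_1 poly"
  assumes "f \<in> moment_span k"
  shows "step_op 1 \<circ> f \<in> source_span (Suc k)"
  using step_op.module_hom_comp_seq subspace_ladder_span assms
proof (rule ladder_span_image)
  fix b e i assume index: "moment_index k b e i"
  have "step_op 1 \<circ> (ladder_seq b e i :: nat \<Rightarrow> 'a poly) = ((*) \<xi> \<circ> ((*) \<xi> \<circ> ladder_seq b e i)) -
      (raising \<circ> ((*) \<xi> \<circ> ladder_seq b e i)) - ((*) \<xi> \<circ> (shifting \<circ> ladder_seq b e i))"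
    by (simp add: fun_eq_iff step_op_1[simplified])
  then show "step_op 1 \<circ> (ladder_seq b e i :: nat \<Rightarrow> 'a poly) \<in> source_span (Suc k)"
    by (simp only: ladder_span_intros(2) mult_\<xi>_mult_\<xi>_in_source_span[OF index]
        raising_mult_\<xi>_in_source_span[OF index] mult_\<xi>_shifting_in_source_span[OF index])
qed

fun rec_solution :: "'a::semiring_1 \<Rightarrow> (nat \<Rightarrow> 'a) \<Rightarrow> nat \<Rightarrow> 'a" where
  "rec_solution c s 0 = 0"
| "rec_solution c s (Suc n) = c * rec_solution c s n + s n"

lemma rec_solution_unique:
  assumes "\<And>n. g (Suc n) = c * g n + s n"
  shows "g = rec_solution c s + (\<lambda>n. c ^ n * g 0)"
proof
  show "g n = (rec_solution c s + (\<lambda>n. c ^ n * g 0)) n" for n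
    by (induction n) (simp_all add: assms algebra_simps)
qed

interpretation rec_solution_\<xi>: module_hom "seq_scale smult" "seq_scale smult"
  "rec_solution \<xi> :: (nat \<Rightarrow> 'a::comm_ring_1 poly) \<Rightarrow> nat \<Rightarrow> 'a poly"
proof unfold_locales
  fix f g :: "nat \<Rightarrow> 'a poly" and c :: 'a
  have "rec_solution \<xi> (f + g) n = (rec_solution \<xi> f + rec_solution \<xi> g) n" for n
    by (induction n) (simp_all add: algebra_simps)
  then show "rec_solution \<xi> (f + g) = rec_solution \<xi> f + rec_solution \<xi> g" ..
  have "rec_solution \<xi> (seq_scale smult c f) n = seq_scale smult c (rec_solution \<xi> f) n" for n
    by (induction n) (simp_all add: seq_scale_apply smult_add_right)
  then show "rec_solution \<xi> (seq_scale smult c f) = seq_scale smult c (rec_solution \<xi> f)" ..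
qed

lemma power_Suc_base: "(of_nat (Suc n) :: 'a::comm_semiring_1) ^ e =
    of_nat n ^ e + (\<Sum>l<e. of_nat (e choose l) * of_nat n ^ l)"
proof -
  have "(of_nat (Suc n) :: 'a) ^ e = (of_nat n + 1) ^ e" by (simp add: add.commute)
  also have "\<dots> = (\<Sum>l\<le>e. of_nat (e choose l) * of_nat n ^ l)" by (simp add: binomial_ring)
  finally show ?thesis by (simp add: add.commute flip: lessThan_Suc_atMost)
qed

lemma ladder_seq_Suc:
  "ladder_seq b e i (Suc n) = \<xi> * ladder_seq b e i n +
    (seq_scale smult (- of_int b) (ladder_seq b e i) +
      (\<Sum>l<e. seq_scale smult (of_nat (e choose l)) (ladder_seq b l (Suc i)))) n"
proof -
  have "ladder_seq b e i (Suc n) = smult (of_nat (Suc n) ^ e) (ladder b (\<xi> ^ (n + Suc i)))"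
    by (simp add: ladder_seq_def)
  also have "\<dots> = ladder_seq b e (Suc i) n +
      (\<Sum>l<e. smult (of_nat (e choose l)) (ladder_seq b l (Suc i) n))"
    unfolding power_Suc_base smult_add_left smult_sum by (simp add: ladder_seq_def)
  also have "ladder_seq b e (Suc i) n =
      \<xi> * ladder_seq b e i n + smult (- of_int b) (ladder_seq b e i n)"
    by (simp add: ladder_seq_def mult_\<xi>_ladder smult_add_right mult.commute)
  finally show ?thesis by (simp add: seq_scale_apply algebra_simps)
qed

lemma ladder_seq_eq_rec_solution:
  "ladder_seq b e i = seq_scale smult (- of_int b) (rec_solution \<xi> (ladder_seq b e i)) +
    (\<Sum>l<e. seq_scale smult (of_nat (e choose l)) (rec_solution \<xi> (ladder_seq b l (Suc i)))) +
    (\<lambda>n. \<xi> ^ n * ladder_seq b e i 0)"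
  using rec_solution_unique[of "ladder_seq b e i", OF ladder_seq_Suc]
  by (simp only: rec_solution_\<xi>.add rec_solution_\<xi>.scale rec_solution_\<xi>.sum)

lemma \<xi>_power_times_in_moment_span:
  assumes "degree r \<le> 2 * k"
  shows "(\<lambda>n. \<xi> ^ n * r) \<in> moment_span k"
proof -
  have "\<xi> ^ n * r = (\<Sum>i\<le>degree r. smult (coeff r i) (\<xi> ^ (n + i)))" for n
  proof -
    have "\<xi> ^ n * r = \<xi> ^ n * (\<Sum>i\<le>degree r. monom (coeff r i) i)"
      by (simp add: poly_as_sum_of_monoms)
    also have "\<dots> = (\<Sum>i\<le>degree r. smult (coeff r i) (\<xi> ^ (n + i)))"
      by (simp add: sum_distrib_left monom_altdef power_add flip: \<xi>_def)
    finally show ?thesis .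
  qed
  then have "(\<lambda>n. \<xi> ^ n * r) = (\<Sum>i\<le>degree r. seq_scale smult (coeff r i) (ladder_seq 0 0 i))"
    by (simp add: fun_eq_iff seq_scale_apply ladder_seq_def)
  then show ?thesis using assms
    by (simp only:) (intro ladder_span_intros; simp add: moment_index_def)
qed

lemma rec_solution_ladder_seq_in_moment_span:
  assumes "b \<noteq> 0"
  shows "nat \<bar>b\<bar> + e + i \<le> 2 * k \<Longrightarrow> 2 * e < k + i \<Longrightarrow>
    (rec_solution \<xi> (ladder_seq b e i) :: nat \<Rightarrow> 'a::field_char_0 poly) \<in> moment_span k"
proof (induction e arbitrary: i rule: less_induct)
  case (less e)
  let ?f = "ladder_seq b e i :: nat \<Rightarrow> 'a poly"
  let ?lower = "\<Sum>l<e. seq_scale smult (of_nat (e choose l))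
      (rec_solution \<xi> (ladder_seq b l (Suc i))) :: nat \<Rightarrow> 'a poly"
  have "rec_solution \<xi> ?f =
      seq_scale smult (- 1 / of_int b) (?f - ?lower - (\<lambda>n. \<xi> ^ n * ?f 0))"
    by (subst (2) ladder_seq_eq_rec_solution) (simp add: assms)
  moreover have "?lower \<in> moment_span k"
    by (intro ladder_span_intros) (use less in auto)
  moreover have "(\<lambda>n. \<xi> ^ n * ?f 0) \<in> moment_span k"
  proof (rule \<xi>_power_times_in_moment_span)
    have "degree (?f 0) \<le> nat \<bar>b\<bar> + degree (\<xi> ^ i :: 'a poly)"
      using degree_ladder_le[of b "\<xi> ^ i"] by (auto simp: ladder_seq_def)
    moreover have "degree (\<xi> ^ i :: 'a poly) \<le> i"
      using degree_power_le[of \<xi> i] by (simp add: \<xi>_def)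
    ultimately show "degree (?f 0) \<le> 2 * k" using less.prems by linarith
  qed
  moreover have "?f \<in> moment_span k"
    by (rule ladder_seq_in_ladder_span) (use less.prems assms in \<open>auto simp: moment_index_def\<close>)
  ultimately show ?case by (simp only: ladder_span_intros)
qed

lemma rec_solution_ladder_seq_0_in_moment_span:
  "e + i < 2 * k \<Longrightarrow> 2 * e + 2 \<le> k + i \<Longrightarrow>
    (rec_solution \<xi> (ladder_seq 0 e (Suc i)) :: nat \<Rightarrow> 'a::field_char_0 poly) \<in> moment_span k"
proof (induction e arbitrary: i rule: less_induct)
  case (less e)
  let ?f = "ladder_seq 0 (Suc e) i :: nat \<Rightarrow> 'a poly"
  let ?lower = "\<Sum>l<e. seq_scale smult (of_nat (Suc e choose l))
      (rec_solution \<xi> (ladder_seq 0 l (Suc i))) :: nat \<Rightarrow> 'a poly"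
  have "?f = ?lower + seq_scale smult (of_nat (Suc e)) (rec_solution \<xi> (ladder_seq 0 e (Suc i)))"
  proof -
    have "(\<lambda>n. \<xi> ^ n * ?f 0) = 0" by (simp add: fun_eq_iff ladder_seq_def)
    then show ?thesis by (subst ladder_seq_eq_rec_solution) simp
  qed
  then have "rec_solution \<xi> (ladder_seq 0 e (Suc i)) =
      seq_scale smult (1 / of_nat (Suc e)) (?f - ?lower)"
    by (simp del: of_nat_Suc)
  moreover have "?lower \<in> moment_span k"
    by (intro ladder_span_intros) (use less in auto)
  moreover have "?f \<in> moment_span k"
    by (rule ladder_seq_in_ladder_span) (use less.prems in \<open>auto simp: moment_index_def\<close>)
  ultimately show ?case by (simp only: ladder_span_intros)
qed

lemma rec_solution_in_moment_span:
  fixes f :: "nat \<Rightarrow> 'a::field_char_0 poly"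
  assumes "f \<in> source_span k"
  shows "rec_solution \<xi> f \<in> moment_span k"
  using rec_solution_\<xi>.module_hom_axioms subspace_ladder_span assms
proof (rule ladder_span_image)
  fix b e i assume index: "source_index k b e i"
  show "rec_solution \<xi> (ladder_seq b e i :: nat \<Rightarrow> 'a poly) \<in> moment_span k"
  proof (cases "b = 0")
    case True
    then obtain i' where "i = Suc i'" using index by (cases i) (auto simp: source_index_def)
    then show ?thesis using True index rec_solution_ladder_seq_0_in_moment_span[of e i' k]
      by (simp add: source_index_def)
  next
    case False
    then show ?thesis using index rec_solution_ladder_seq_in_moment_span[of b e i k]
      by (simp add: source_index_def)
  qed
qed

lemma moment_poly_eq_rec_solution:
  assumes "k > 0"
  shows "moment_poly k =
    rec_solution \<xi> (\<Sum>j\<in>{1..k}. seq_scale smult (of_nat (k choose j))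
      (step_op j \<circ> moment_poly (k - j)))"
    (is "_ = rec_solution \<xi> ?s")
proof -
  have "moment_poly k (Suc n) = \<xi> * moment_poly k n + ?s n" for n
  proof -
    have "{..k} = insert 0 {1..k}" by auto
    then show ?thesis by (simp add: moment_poly_Suc step_op_0 seq_scale_apply)
  qed
  then have "moment_poly k = rec_solution \<xi> ?s + (\<lambda>n. \<xi> ^ n * moment_poly k 0)"
    by (rule rec_solution_unique)
  then show ?thesis using assms by (simp add: moment_poly_0 flip: zero_fun_def)
qed

lemma moment_poly_in_moment_span:
  "(moment_poly k :: nat \<Rightarrow> 'a::field_char_0 poly) \<in> moment_span k"
proof (induction k rule: less_induct)
  case (less k)
  show ?case
  proof (cases "k = 0")
    case True
    have "moment_poly 0 = (ladder_seq 0 0 0 :: nat \<Rightarrow> 'a poly)"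
      by (simp add: fun_eq_iff ladder_seq_def moment_poly_zero)
    then show ?thesis using True by (simp add: ladder_seq_in_ladder_span moment_index_def)
  next
    case False
    have "step_op j \<circ> (moment_poly (k - j) :: nat \<Rightarrow> 'a poly) \<in> source_span k"
      if "j \<in> {1..k}" for j
    proof -
      have "moment_poly (k - j) \<in> (moment_span (k - j) :: (nat \<Rightarrow> 'a poly) set)"
        using less that by simp
      then show ?thesis
        using step_op_1_in_source_span[of _ "k - j"] step_op_in_source_span[of _ "k - j" j] that
        by (cases "j = 1") auto
    qed
    then show ?thesis
      unfolding moment_poly_eq_rec_solution[OF False[unfolded neq0_conv]]
      by (intro rec_solution_in_moment_span ladder_span_intros)
  qed
qed

section \<open>Combinations of Bell numbers\<close>

interpretation scalar_seq: module "seq_scale (*) :: 'a::comm_ring_1 \<Rightarrow> (nat \<Rightarrow> 'a) \<Rightarrow> nat \<Rightarrow> 'a"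
  by (rule module_over_itself.module_seq_scale)

interpretation bell_functional_seq: module_hom "seq_scale smult" "seq_scale (*)"
  "(\<circ>) bell_functional :: (nat \<Rightarrow> 'a::field_char_0 poly) \<Rightarrow> nat \<Rightarrow> 'a"
  by (rule bell_functional.module_hom_comp_seq)

definition bell_seq :: "nat \<Rightarrow> nat \<Rightarrow> nat \<Rightarrow> 'a::comm_ring_1" where
  "bell_seq e i n = of_nat n ^ e * of_nat (bell (n + i))"

definition bell_span :: "nat \<Rightarrow> (nat \<Rightarrow> 'a::comm_ring_1) set" where
  "bell_span k = scalar_seq.span {bell_seq e i | e i. e + i \<le> 2 * k \<and> 2 * e \<le> k + i}"

lemma subspace_bell_span: "scalar_seq.subspace (bell_span k)"
  by (simp add: bell_span_def)

lemma bell_seq_in_bell_span: "e + i \<le> 2 * k \<Longrightarrow> 2 * e \<le> k + i \<Longrightarrow> bell_seq e i \<in> bell_span k"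
  unfolding bell_span_def by (rule scalar_seq.span_base) blast

lemma bell_functional_ladder_seq_nonneg:
  assumes "b \<ge> 0"
  shows "bell_functional \<circ> ladder_seq b e i = bell_seq e i"
proof -
  have "bell_functional ((raising ^^ m) f) = bell_functional f" for m and f :: "'a poly"
    by (induction m) simp_all
  then show ?thesis
    using assms by (simp add: fun_eq_iff ladder_seq_def ladder_def bell_functional.scale
        bell_functional_power bell_seq_def)
qed

lemma bell_functional_ladder_seq_diff_1:
  assumes "b \<le> 0"
  shows "bell_functional \<circ> ladder_seq (b - 1) e i =
    (bell_functional \<circ> ladder_seq b e (Suc i)) +
    seq_scale (*) (of_int b) (bell_functional \<circ> ladder_seq b e i)"
proof -
  have "bell_functional \<circ> ladder_seq (b - 1) e i = bell_functional \<circ> (shifting \<circ> ladder_seq b e i)"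
    using assms by (simp add: shifting_ladder_seq)
  also have "\<dots> = bell_functional \<circ> ((*) \<xi> \<circ> ladder_seq b e i)"
    by (simp add: fun_eq_iff bell_functional_shifting)
  finally show ?thesis
    by (simp add: mult_\<xi>_ladder_seq bell_functional_seq.add bell_functional_seq.scale)
qed

lemma bell_functional_ladder_seq_neg_in_bell_span:
  "c + e + i \<le> 2 * k \<Longrightarrow> 2 * e \<le> k + i \<Longrightarrow>
    bell_functional \<circ> ladder_seq (- int c) e i \<in> bell_span k"
proof (induction c arbitrary: i)
  case 0
  then show ?case by (simp add: bell_functional_ladder_seq_nonneg bell_seq_in_bell_span)
next
  case (Suc c)
  have "- int (Suc c) = - int c - 1" "- int c \<le> 0" by simp_all
  then show ?case
    by (simp only: bell_functional_ladder_seq_diff_1)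
      (intro scalar_seq.subspace_add[OF subspace_bell_span]
        scalar_seq.subspace_scale[OF subspace_bell_span] Suc.IH; use Suc.prems in simp)
qed

lemma bell_functional_in_bell_span:
  assumes "f \<in> moment_span k"
  shows "bell_functional \<circ> f \<in> bell_span k"
  using bell_functional_seq.module_hom_axioms subspace_bell_span assms
proof (rule ladder_span_image)
  fix b e i assume "moment_index k b e i"
  then have "nat \<bar>b\<bar> + e + i \<le> 2 * k" "2 * e \<le> k + i"
    by (auto simp: moment_index_def split: if_splits)
  then show "bell_functional \<circ> ladder_seq b e i \<in> bell_span k"
    using bell_functional_ladder_seq_neg_in_bell_span[of "nat (- b)" e i k]
    by (cases "b \<ge> 0") (simp_all add: bell_functional_ladder_seq_nonneg bell_seq_in_bell_span)
qed

lemma bell_span_imp_polynomials: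
  assumes "h \<in> bell_span k"
  shows "\<exists>P. (\<forall>n. h n = (\<Sum>i = 0..2 * k. poly (P i) (of_nat n) * of_nat (bell (n + i)))) \<and>
    (\<forall>i. degree (P i) \<le> 2 * k - i \<and> 2 * degree (P i) \<le> k + i)"
  using assms unfolding bell_span_def
proof (induction rule: scalar_seq.span_induct_alt)
  case base
  show ?case by (rule exI[of _ "\<lambda>i. 0"]) simp
next
  case (step c g h)
  then obtain e i P where g: "g = bell_seq e i" and index: "e + i \<le> 2 * k" "2 * e \<le> k + i"
    and h: "\<And>n. h n = (\<Sum>i = 0..2 * k. poly (P i) (of_nat n) * of_nat (bell (n + i)))"
    and deg: "\<And>i. degree (P i) \<le> 2 * k - i \<and> 2 * degree (P i) \<le> k + i"
    by blast
  define Q where "Q = P(i := monom c e + P i)"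
  have "poly (Q l) (of_nat n) * of_nat (bell (n + l)) =
      (if l = i then c * bell_seq e i n else 0) +
      poly (P l) (of_nat n) * of_nat (bell (n + l))" for l n
    by (simp add: Q_def poly_monom bell_seq_def algebra_simps)
  then have "(seq_scale (*) c g + h) n =
      (\<Sum>l = 0..2 * k. poly (Q l) (of_nat n) * of_nat (bell (n + l)))" for n
    using index by (simp add: g h seq_scale_apply sum.distrib)
  moreover have "degree (Q l) \<le> 2 * k - l \<and> 2 * degree (Q l) \<le> k + l" for l
  proof -
    have "degree (monom c e + P i) \<le> max e (degree (P i))"
      by (intro degree_add_le) (auto simp: degree_monom_le le_max_iff_disj)
    then show ?thesis using deg[of l] index by (auto simp: Q_def)
  qed
  ultimately show ?case by blast
qed

lemma dim_moment_in_bell_span: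
  "(\<lambda>n. of_int (dim_moment k n)) \<in> (bell_span k :: (nat \<Rightarrow> 'a::field_char_0) set)"
proof -
  have "(\<lambda>n. of_int (dim_moment k n)) = bell_functional \<circ> (moment_poly k :: nat \<Rightarrow> 'a poly)"
    by (simp add: fun_eq_iff bell_functional_moment_poly)
  then show ?thesis using bell_functional_in_bell_span[OF moment_poly_in_moment_span[of k]] by simp
qed

lemma le_diff_ceiling_half:
  assumes "2 * d + j \<le> 3 * k"
  shows "int d \<le> int k - \<lceil>(of_nat j - of_nat k) / 2 :: rat\<rceil>"
proof -
  have "(of_nat (2 * d + j) :: rat) \<le> of_nat (3 * k)" using assms by (simp only: of_nat_le_iff)
  then have "(of_nat j - of_nat k) / 2 \<le> (of_int (int k - int d) :: rat)" by simp
  then have "\<lceil>(of_nat j - of_nat k) / 2 :: rat\<rceil> \<le> int k - int d" by (simp only: ceiling_le_iff)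
  then show ?thesis by linarith
qed

section \<open>The first two moments\<close>

lemma moment_poly_eqI:
  assumes "k > 0" "g 0 = 0"
    and "\<And>n. g (Suc n) =
      \<xi> * g n + (\<Sum>j\<in>{1..k}. smult (of_nat (k choose j)) (step_op j (moment_poly (k - j) n)))"
  shows "moment_poly k = g"
proof -
  let ?s = "\<Sum>j\<in>{1..k}. seq_scale smult (of_nat (k choose j)) (step_op j \<circ> moment_poly (k - j))"
  have "g (Suc n) = \<xi> * g n + ?s n" for n by (simp add: assms(3) seq_scale_apply)
  then have "g = rec_solution \<xi> ?s + (\<lambda>n. \<xi> ^ n * g 0)" by (rule rec_solution_unique)
  then show ?thesis
    using moment_poly_eq_rec_solution[OF assms(1)] assms(2) by (simp flip: zero_fun_def)
qed

lemma poly_ext: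
  fixes f g :: "'a::field_char_0 poly"
  shows "(\<And>x. poly f x = poly g x) \<Longrightarrow> f = g"
  by (simp add: poly_eq_poly_eq_iff[symmetric] fun_eq_iff)

lemma poly_\<xi> [simp]: "poly \<xi> x = x"
  by (simp add: \<xi>_def)

lemma poly_raising: "poly (raising f) x = x * poly f (x - 1)"
  by (simp add: raising_def poly_pcompose)

lemma poly_shifting: "poly (shifting f) x = poly f (x + 1)"
  by (simp add: shifting_def poly_pcompose add.commute)

lemma poly_ladder_seq:
  "poly (ladder_seq 0 e i n) x = of_nat n ^ e * x ^ (n + i)"
  "poly (ladder_seq 1 e i n) x = of_nat n ^ e * (x * (x - 1) ^ (n + i))"
  "poly (ladder_seq 2 e i n) x = of_nat n ^ e * (x * (x - 1) * (x - 2) ^ (n + i))"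
  "poly (ladder_seq (- 1) e i n) x = of_nat n ^ e * (x + 1) ^ (n + i)"
  "poly (ladder_seq (- 2) e i n) x = of_nat n ^ e * (x + 2) ^ (n + i)"
  by (simp_all add: ladder_seq_def ladder_def poly_raising poly_shifting poly_power numeral_2_eq_2
      diff_diff_eq add.assoc mult.assoc)

lemma bell_functional_ladder_seq:
  "bell_functional (ladder_seq 0 e i n) = of_nat n ^ e * of_nat (bell (n + i))"
  "bell_functional (ladder_seq 1 e i n) = of_nat n ^ e * of_nat (bell (n + i))"
  "bell_functional (ladder_seq 2 e i n) = of_nat n ^ e * of_nat (bell (n + i))"
  "bell_functional (ladder_seq (- 1) e i n) = of_nat n ^ e * of_nat (bell (n + i + 1))"
  "bell_functional (ladder_seq (- 2) e i n) =
    of_nat n ^ e * (of_nat (bell (n + i + 2)) - of_nat (bell (n + i + 1)))"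
  by (simp_all add: comp_eq_dest_lhs[OF bell_functional_ladder_seq_nonneg]
      comp_eq_dest_lhs[OF bell_functional_ladder_seq_diff_1[of 0], simplified]
      comp_eq_dest_lhs[OF bell_functional_ladder_seq_diff_1[of "-1"], simplified]
      bell_seq_def seq_scale_apply algebra_simps)

text \<open>The coefficients below result from solving the recurrence term by term, as in the proofs of
  \<open>rec_solution_ladder_seq_in_moment_span\<close> and \<open>rec_solution_ladder_seq_0_in_moment_span\<close>.\<close>

lemma moment_poly_1: "moment_poly 1 = (\<lambda>n.
    ladder_seq (- 1) 0 0 n - ladder_seq (- 1) 0 1 n
    + smult 2 (ladder_seq 0 0 1 n) - ladder_seq 0 0 2 n + ladder_seq 0 1 1 n
    + ladder_seq 1 0 1 n :: 'a::field_char_0 poly)"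
  (is "_ = ?g")
proof (rule moment_poly_eqI)
  show "?g 0 = 0"
    by (rule poly_ext) (simp add: poly_ladder_seq algebra_simps power2_eq_square)
  show "?g (Suc n) = \<xi> * ?g n +
    (\<Sum>j\<in>{1..1}. smult (of_nat (1 choose j)) (step_op j (moment_poly (1 - j) n)))" for n
    by (rule poly_ext)
      (simp add: poly_ladder_seq moment_poly_zero step_op_1[simplified] poly_raising poly_shifting
        poly_power algebra_simps power2_eq_square)
qed simp

lemma moment_poly_2: "moment_poly 2 = (\<lambda>n.
    ladder_seq (- 2) 0 0 n - smult (5/2) (ladder_seq (- 2) 0 1 n) + ladder_seq (- 2) 0 2 n
    + ladder_seq (- 1) 0 0 n + ladder_seq (- 1) 0 1 n - smult 4 (ladder_seq (- 1) 0 2 n)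
    + smult 2 (ladder_seq (- 1) 0 3 n)
    + smult 2 (ladder_seq (- 1) 1 1 n) - smult 2 (ladder_seq (- 1) 1 2 n)
    - smult (5/2) (ladder_seq 0 0 1 n) + smult (3/2) (ladder_seq 0 0 2 n)
    - smult (11/2) (ladder_seq 0 0 3 n) + ladder_seq 0 0 4 n
    + ladder_seq 0 1 0 n - smult 4 (ladder_seq 0 1 1 n) + smult 4 (ladder_seq 0 1 2 n)
    - smult 2 (ladder_seq 0 1 3 n) + ladder_seq 0 2 2 n
    - ladder_seq 1 0 1 n + smult 2 (ladder_seq 1 0 2 n) - smult 2 (ladder_seq 1 0 3 n)
    + smult 2 (ladder_seq 1 1 2 n)
    + smult (1/2) (ladder_seq 2 0 1 n) + ladder_seq 2 0 2 n :: 'a::field_char_0 poly)"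
  (is "_ = ?g")
proof (rule moment_poly_eqI)
  show "?g 0 = 0"
    by (rule poly_ext)
      (simp add: poly_ladder_seq power2_eq_square power3_eq_cube power4_eq_xxxx algebra_simps)
  fix n
  have source: "(\<Sum>j\<in>{1..2}. smult (of_nat (2 choose j)) (step_op j (moment_poly (2 - j) n))) =
      smult 2 (step_op 1 (moment_poly 1 n)) + step_op 2 (\<xi> ^ n :: 'a poly)"
    by (simp add: numeral_2_eq_2 moment_poly_zero)
  show "?g (Suc n) = \<xi> * ?g n +
    (\<Sum>j\<in>{1..2}. smult (of_nat (2 choose j)) (step_op j (moment_poly (2 - j) n)))"
    unfolding source moment_poly_1 step_op_1
    by (rule poly_ext)
      (simp add: poly_ladder_seq step_op_def number_op_altdef numeral_2_eq_2 poly_raising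
        poly_shifting poly_power power_add power_numeral_reduce algebra_simps)
qed simp

lemma dim_moment_1: "dim_moment 1 n = - 2 * int (bell (n + 2)) + (int n + 4) * int (bell (n + 1))"
proof -
  have "(of_int (dim_moment 1 n) :: rat) =
      of_int (- 2 * int (bell (n + 2)) + (int n + 4) * int (bell (n + 1)))"
    unfolding bell_functional_moment_poly[symmetric] moment_poly_1
    by (simp add: bell_functional.add bell_functional.diff bell_functional.scale
        bell_functional_ladder_seq algebra_simps)
  then show ?thesis by (simp only: of_int_eq_iff)
qed

lemma dim_moment_2: "dim_moment 2 n = 4 * int (bell (n + 4)) - (4 * int n + 15) * int (bell (n + 3))
    + ((int n)\<^sup>2 + 8 * int n + 9) * int (bell (n + 2))
    - (4 * int n + 3) * int (bell (n + 1)) + int n * int (bell n)"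
  (is "_ = ?rhs")
proof -
  have "(of_int (dim_moment 2 n) :: rat) = of_int ?rhs"
    unfolding bell_functional_moment_poly[symmetric] moment_poly_2
    by (simp add: bell_functional.add bell_functional.diff bell_functional.scale
        bell_functional_ladder_seq eval_nat_numeral algebra_simps)
  then show ?thesis by (simp only: of_int_eq_iff)
qed

theorem theorem3p2:
  shows "(\<forall>k::nat. \<exists>P :: nat \<Rightarrow> rat poly.
           (\<forall>n::nat. of_int (dim_moment k n)
              = (\<Sum>i = 0..2 * k. poly (P i) (of_nat n) * of_nat (bell (n + i)))) \<and>
           (\<forall>j \<le> 2 * k.
              (j \<le> k \<longrightarrow> degree (P (2 * k - j)) \<le> j) \<and>
              (j > k \<longrightarrow> int (degree (P (2 * k - j)))
                            \<le> int k - \<lceil>(of_nat j - of_nat k) / 2 :: rat\<rceil>)))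
       \<and> (\<forall>n::nat. dim_moment 1 n
            = - 2 * int (bell (n + 2)) + (int n + 4) * int (bell (n + 1)))
       \<and> (\<forall>n::nat. dim_moment 2 n
            = 4 * int (bell (n + 4)) - (4 * int n + 15) * int (bell (n + 3))
              + ((int n)\<^sup>2 + 8 * int n + 9) * int (bell (n + 2))
              - (4 * int n + 3) * int (bell (n + 1)) + int n * int (bell n))"
  (is "(\<forall>k. \<exists>P. ?moment k P \<and> ?degrees k P) \<and> _")
proof (intro conjI allI)
  fix k
  obtain P :: "nat \<Rightarrow> rat poly" where moment: "?moment k P"
    and deg: "\<And>i. degree (P i) \<le> 2 * k - i \<and> 2 * degree (P i) \<le> k + i"
    using bell_span_imp_polynomials[OF dim_moment_in_bell_span[of k]] by blast
  have "?degrees k P"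
  proof (intro allI impI conjI)
    fix j assume "j \<le> 2 * k"
    then show "degree (P (2 * k - j)) \<le> j" using deg[of "2 * k - j"] by simp
    show "int (degree (P (2 * k - j))) \<le> int k - \<lceil>(of_nat j - of_nat k) / 2 :: rat\<rceil>"
      using deg[of "2 * k - j"] \<open>j \<le> 2 * k\<close> by (intro le_diff_ceiling_half) linarith
  qed
  with moment show "\<exists>P. ?moment k P \<and> ?degrees k P" by (intro exI[of _ P] conjI)
qed (rule dim_moment_1 dim_moment_2)+

end
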